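(* Let $U$ be a Pisot numeration that preserves zeros. For each $g\in\mathbb{G}$ there exists $g'\in\overline{\mathbb{N}}_U$ such that $g-g'\in\mathbb{H}_U$.
   Context: A Pisot number is a real algebraic integer $\beta>1$ all of whose other Galois conjugates have modulus strictly less than $1$. Let $P(X)=X^d-a_{d-1}X^{d-1}-\cdots-a_1X-a_0\in\mathbb{Z}[X]$ be its minimal polynomial. A Pisot numeration of degree $d$ associated to $\beta$ is a sequence $U=(u_n)_{n\ge0}$ of strictly positive integers with $u_0=1$, given by integer initial conditions $u_0=1,u_{-1},\dots,u_{-d+1}$ and the recurrence $u_n=a_{d-1}u_{n-1}+\cdots+a_0u_{n-d}$ for all $n\ge1$. Finite sequences of integers $g=g_k\cdots g_0\in\mathbb{Z}^*$ are identified with sequences $(g_n)_{n\ge0}$ with $g_n=0$ for $n>k$; $[g]_U=\sum_i g_iu_i$. For $n\in\mathbb{N}$, $(n)_U$ is the normalised (greedy) expansion of $n$: the lexicographically greatest finite sequence $(d_i)_{i\ge 0}$ of non-negative integers with $\sum_i d_iu_i=n$, characterised by $\sum_{i=0}^{\ell}d_iu_i<u_{\ell+1}$ for each $\ell\ge0$. $\operatorname{ord}(g)=\inf\{n:g_n\ne0\}$ ($=\infty$ for the zero sequence), $\|g\|_\infty=\sup_n|g_n|$, $\nu_U(n)=\operatorname{ord}((|n|)_U)$ for $n\in\mathbb{Z}$, and $\nu_U(g)=\nu_U([g]_U)$ for finite $g$. $U$ preserves zeros if for each natural number $c$ there is a constant $K_c$ such that $\nu_U(g)\ge\operatorname{ord}(g)-K_c$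 for each $g\in\mathbb{Z}^*$ with $\|g\|_\infty\le c$. $\mathbb{G}$ is the abelian group of bounded sequences $g=(g_n)_{n\ge0}$ of integers under component-wise addition; $g_{[0:n)}=g_{n-1}\cdots g_0$; $\mathbb{H}_U=\{g\in\mathbb{G}:\lim_{n\to\infty}\nu_U(g_{[0:n)})=\infty\}$. $\mathbb{N}_U=\{(n)_U:n\in\mathbb{N}\}$ (expansions may be padded with leading zeros), and $\overline{\mathbb{N}}_U=\{g\in\mathbb{G}:g_{[0:n)}\in\mathbb{N}_U\text{ for each }n\ge0\}$ is the set of $U$-normalised sequences. *)

theory Defs
  imports
    Complex_Main
    "HOL-Computational_Algebra.Polynomial"
    "HOL-Library.Extended_Real"
begin

definition minimal_polynomial :: "rat poly \<Rightarrow> complex \<Rightarrow> bool" where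
  "minimal_polynomial p z \<longleftrightarrow>
     lead_coeff p = 1 \<and> poly (map_poly of_rat p) z = 0 \<and>
     (\<forall>q. q \<noteq> 0 \<longrightarrow> poly (map_poly of_rat q) z = 0 \<longrightarrow> degree p \<le> degree q)"

definition galois_conjugate :: "complex \<Rightarrow> complex \<Rightarrow> bool" where
  "galois_conjugate z w \<longleftrightarrow>
     (\<exists>p. minimal_polynomial p z \<and> poly (map_poly of_rat p) w = 0)"

definition pisot_number :: "real \<Rightarrow> bool" where
  "pisot_number \<beta> \<longleftrightarrow> algebraic_int \<beta> \<and> \<beta> > 1 \<and>
     (\<forall>z. galois_conjugate (of_real \<beta>) z \<longrightarrow> z \<noteq> of_real \<beta> \<longrightarrow> norm z < 1)"

text \<open>The minimal polynomial is written \<open>P = X^d - a_{d-1} X^{d-1} - \<dots> - a_0\<close>, so that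
  \<open>a_i = - coeff P i\<close>. The function \<open>v\<close> extends \<open>u\<close> to negative indices; only its
  values at indices \<open>\<ge> 1 - d\<close> play a role.\<close>

definition pisot_numeration :: "nat \<Rightarrow> real \<Rightarrow> (nat \<Rightarrow> int) \<Rightarrow> bool" where
  "pisot_numeration d \<beta> u \<longleftrightarrow> pisot_number \<beta> \<and> (\<forall>n. u n > 0) \<and> u 0 = 1 \<and>
     (\<exists>(P :: int poly) (v :: int \<Rightarrow> int).
        minimal_polynomial (map_poly of_int P) (of_real \<beta>) \<and> degree P = d \<and>
        (\<forall>n. v (int n) = u n) \<and>
        (\<forall>n\<ge>1. v n = (\<Sum>i<d. - coeff P i * v (n - int d + int i))))"

text \<open>A finite word \<open>g_k \<dots> g_0\<close> is represented by the finitely supported sequence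
  \<open>(g_n)_{n \<ge> 0}\<close>; words that differ by leading zeros are thereby identified.\<close>

definition finite_seqs :: "(nat \<Rightarrow> int) set" where
  "finite_seqs = {g. finite {n. g n \<noteq> 0}}"

definition seq_value :: "(nat \<Rightarrow> int) \<Rightarrow> (nat \<Rightarrow> int) \<Rightarrow> int" where
  "seq_value u g = (\<Sum>i | g i \<noteq> 0. g i * u i)"

text \<open>Lexicographic order with the most significant digit (highest index) first.\<close>

definition lex_less :: "(nat \<Rightarrow> int) \<Rightarrow> (nat \<Rightarrow> int) \<Rightarrow> bool" where
  "lex_less e d \<longleftrightarrow> (\<exists>k. e k < d k \<and> (\<forall>j>k. e j = d j))"

definition representations :: "(nat \<Rightarrow> int) \<Rightarrow> nat \<Rightarrow> (nat \<Rightarrow> int) set" where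
  "representations u n = {d \<in> finite_seqs. (\<forall>i. d i \<ge> 0) \<and> seq_value u d = int n}"

definition greedy_expansion :: "(nat \<Rightarrow> int) \<Rightarrow> nat \<Rightarrow> (nat \<Rightarrow> int)" where
  "greedy_expansion u n =
     (THE d. d \<in> representations u n \<and> (\<forall>e\<in>representations u n. e \<noteq> d \<longrightarrow> lex_less e d))"

definition seq_ord :: "(nat \<Rightarrow> int) \<Rightarrow> enat" where
  "seq_ord g = (INF n\<in>{n. g n \<noteq> 0}. enat n)"

definition bounded_seqs :: "(nat \<Rightarrow> int) set" where
  "bounded_seqs = {g. \<exists>B. \<forall>n. \<bar>g n\<bar> \<le> B}"

text \<open>The supremum is meaningful for bounded sequences only.\<close>

definition sup_norm :: "(nat \<Rightarrow> int) \<Rightarrow> int" where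
  "sup_norm g = (SUP n. \<bar>g n\<bar>)"

definition int_val :: "(nat \<Rightarrow> int) \<Rightarrow> int \<Rightarrow> enat" where
  "int_val u n = seq_ord (greedy_expansion u (nat \<bar>n\<bar>))"

definition seq_val :: "(nat \<Rightarrow> int) \<Rightarrow> (nat \<Rightarrow> int) \<Rightarrow> enat" where
  "seq_val u g = int_val u (seq_value u g)"

text \<open>Subtraction on \<^typ>\<open>enat\<close> is truncated at 0, which is harmless here as the left-hand
  side is never negative; for the zero sequence the right-hand side is \<open>\<infinity>\<close>.\<close>

definition preserves_zeros :: "(nat \<Rightarrow> int) \<Rightarrow> bool" where
  "preserves_zeros u \<longleftrightarrow>
     (\<forall>c::nat. \<exists>K::nat. \<forall>g\<in>finite_seqs. sup_norm g \<le> int c \<longrightarrow>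
        seq_val u g \<ge> seq_ord g - enat K)"

definition truncate_seq :: "(nat \<Rightarrow> int) \<Rightarrow> nat \<Rightarrow> (nat \<Rightarrow> int)" where
  "truncate_seq g n = (\<lambda>i. if i < n then g i else 0)"

definition null_seqs :: "(nat \<Rightarrow> int) \<Rightarrow> (nat \<Rightarrow> int) set" where
  "null_seqs u = {g \<in> bounded_seqs. (\<lambda>n. seq_val u (truncate_seq g n)) \<longlonglongrightarrow> \<infinity>}"

definition normalised_finite :: "(nat \<Rightarrow> int) \<Rightarrow> (nat \<Rightarrow> int) set" where
  "normalised_finite u = range (greedy_expansion u)"

definition normalised_seqs :: "(nat \<Rightarrow> int) \<Rightarrow> (nat \<Rightarrow> int) set" where
  "normalised_seqs u = {g \<in> bounded_seqs. \<forall>n. truncate_seq g n \<in> normalised_finite u}"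

end

theory Submission
  imports Defs "HOL-Computational_Algebra.Fundamental_Theorem_Algebra"
begin

text \<open>
  The idea is compactness. Write \<open>x N\<close> for the value of the truncation of \<open>g\<close> to the positions
  below \<open>N\<close>. This integer may be negative, so add \<open>u m\<close> for some \<open>m \<ge> N\<close> that makes the
  sum nonnegative, and let \<open>w N\<close> be the normalised expansion of \<open>x N + u m\<close>. The extra term only
  puts one more digit at a position beyond \<open>N\<close>. Normalised digits are uniformly bounded, so the
  sequences \<open>w N\<close> have a cluster point \<open>g'\<close> for pointwise convergence
  (\<open>prefixwise_cluster_point\<close>); its truncations are truncations of the \<open>w N\<close>, hence normalised.

  Given \<open>n\<close>, choose \<open>N \<ge> n\<close> such that \<open>w N\<close> and \<open>g'\<close> agree below \<open>n\<close>. As \<open>w N\<close> has the value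
  \<open>x N + u m\<close>, the truncation of \<open>g - g'\<close> below \<open>n\<close> has the same value as the finite sequence
  made of the digits of \<open>w N\<close> from \<open>n\<close> on, minus the digits of \<open>g\<close> in \<open>[n, N)\<close>, minus a digit 1 at
  \<open>m\<close>. That sequence vanishes below \<open>n\<close> and is bounded independently of \<open>n\<close>, so preservation of
  zeros bounds the valuation of its value below by \<open>n - K\<close> with a fixed \<open>K\<close>.

  The Pisot property enters through two facts about \<open>u\<close>: it is unbounded with finite sublevel sets
  (needed for the existence of greedy expansions and of \<open>m\<close>), and the ratios of consecutive terms
  are bounded (needed to bound the digits). Both follow from
  \<open>pisot_numeration_error_tendsto_zero\<close>: the differences \<open>u (n + 1) - \<beta> * u n\<close> satisfy the linear
  recurrence whose characteristic roots are the conjugates of \<open>\<beta>\<close> other than \<open>\<beta>\<close>, so they tend to 0.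
\<close>

section \<open>Linear recurrences whose characteristic roots lie in the open unit disc\<close>

text \<open>This is the operator \<open>p(S)\<close>, where \<open>S\<close> is the shift \<open>y \<mapsto> (\<lambda>n. y (n + 1))\<close>. A sequence
  satisfies the recurrence with characteristic polynomial \<open>p\<close> iff \<open>p(S)\<close> annihilates it.\<close>

definition apply_shift_poly :: "complex poly \<Rightarrow> (nat \<Rightarrow> complex) \<Rightarrow> nat \<Rightarrow> complex" where
  "apply_shift_poly p y n = (\<Sum>i\<le>degree p. coeff p i * y (n + i))"

lemma apply_shift_poly_sum_upto:
  assumes "degree p \<le> N"
  shows "apply_shift_poly p y n = (\<Sum>i\<le>N. coeff p i * y (n + i))"
  unfolding apply_shift_poly_def
  using assms by (intro sum.mono_neutral_left) (auto simp: coeff_eq_0)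

lemma apply_shift_poly_linear_factor:
  "apply_shift_poly ([:- r, 1:] * p) y n = apply_shift_poly p y (Suc n) - r * apply_shift_poly p y n"
proof -
  define N where "N = degree p"
  have deg: "degree ([:- r, 1:] * p) \<le> Suc N"
    unfolding N_def using degree_mult_le[of "[:- r, 1:]" p] by simp
  have "apply_shift_poly ([:- r, 1:] * p) y n
      = (\<Sum>i\<le>Suc N. coeff (smult (- r) p + pCons 0 p) i * y (n + i))"
    using apply_shift_poly_sum_upto[OF deg] by simp
  also have "\<dots> = (\<Sum>i\<le>Suc N. coeff (pCons 0 p) i * y (n + i))
                  - r * (\<Sum>i\<le>Suc N. coeff p i * y (n + i))"
    by (simp add: algebra_simps sum.distrib sum_distrib_left sum_subtractf sum_negf
        del: sum.atMost_Suc)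
  also have "(\<Sum>i\<le>Suc N. coeff (pCons 0 p) i * y (n + i)) = apply_shift_poly p y (Suc n)"
    by (subst sum.atMost_Suc_shift) (simp add: apply_shift_poly_def N_def)
  also have "(\<Sum>i\<le>Suc N. coeff p i * y (n + i)) = apply_shift_poly p y n"
    by (rule apply_shift_poly_sum_upto[symmetric]) (simp add: N_def)
  finally show ?thesis .
qed

text \<open>\<open>p(S)\<close> commutes with \<open>S - r\<close>. With the previous lemma, this lets a linear factor act either before or
  after the remaining ones.\<close>

lemma apply_shift_poly_difference:
  "apply_shift_poly p (\<lambda>n. y (Suc n) - r * y n) n
     = apply_shift_poly p y (Suc n) - r * apply_shift_poly p y n"
  by (simp add: apply_shift_poly_def sum_subtractf sum_distrib_left algebra_simps)

text \<open>Once the perturbation is below \<open>(1 - \<rho>) e / 2\<close> with \<open>\<rho> = norm r\<close>, one step maps the ball of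
  radius \<open>e / 2\<close> into itself and contracts the excess over that radius by the factor \<open>\<rho>\<close>.\<close>

lemma perturbed_contraction_tendsto_zero:
  fixes z :: "nat \<Rightarrow> complex"
  assumes lim: "(\<lambda>n. z (Suc n) - r * z n) \<longlonglongrightarrow> 0" and r: "norm r < 1"
  shows "z \<longlonglongrightarrow> 0"
proof (rule LIMSEQ_I)
  fix e :: real assume e: "e > 0"
  define \<rho> where "\<rho> = norm r"
  have \<rho>: "0 \<le> \<rho>" "\<rho> < 1" using r by (auto simp: \<rho>_def)
  have "e / 2 * (1 - \<rho>) > 0" using e \<rho> by simp
  from LIMSEQ_D[OF lim this] obtain N
    where N: "\<And>n. n \<ge> N \<Longrightarrow> norm (z (Suc n) - r * z n) < e / 2 * (1 - \<rho>)" by auto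
  have bound: "norm (z (N + k)) \<le> \<rho> ^ k * norm (z N) + e / 2" for k
  proof (induction k)
    case 0
    then show ?case using e by simp
  next
    case (Suc k)
    have "norm (z (N + Suc k)) \<le> norm (z (Suc (N + k)) - r * z (N + k)) + norm (r * z (N + k))"
      using norm_triangle_ineq[of "z (Suc (N + k)) - r * z (N + k)" "r * z (N + k)"] by simp
    also have "\<dots> \<le> e / 2 * (1 - \<rho>) + \<rho> * norm (z (N + k))"
      using N[of "N + k"] by (simp add: norm_mult \<rho>_def)
    also have "\<dots> \<le> e / 2 * (1 - \<rho>) + \<rho> * (\<rho> ^ k * norm (z N) + e / 2)"
      using Suc \<rho> by (intro add_left_mono mult_left_mono) auto
    also have "\<dots> = \<rho> ^ Suc k * norm (z N) + e / 2" by (simp add: field_simps)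
    finally show ?case .
  qed
  have "(\<lambda>k. \<rho> ^ k * norm (z N)) \<longlonglongrightarrow> 0 * norm (z N)"
    using \<rho> by (intro tendsto_intros LIMSEQ_realpow_zero) auto
  then have "(\<lambda>k. \<rho> ^ k * norm (z N)) \<longlonglongrightarrow> 0" by simp
  from LIMSEQ_D[OF this, of "e / 2"] obtain M
    where M: "\<And>k. k \<ge> M \<Longrightarrow> norm (\<rho> ^ k * norm (z N)) < e / 2" using e by auto
  have "norm (z n - 0) < e" if "n \<ge> N + M" for n
  proof -
    have "n - N \<ge> M" "n = N + (n - N)" using that by auto
    then show ?thesis
      using bound[of "n - N"] M[of "n - N"] abs_ge_self[of "\<rho> ^ (n - N) * norm (z N)"] by simp
  qed
  then show "\<exists>no. \<forall>n\<ge>no. norm (z n - 0) < e" by blast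
qed

text \<open>Splitting \<open>p\<close> into linear factors over the complex numbers reduces the claim to the contraction
  lemma, one root at a time. Repeated roots are thereby
  covered as well, without an explicit formula for the solutions of the recurrence.\<close>

lemma shift_poly_inverse_tendsto_zero:
  assumes "p \<noteq> 0" and "\<And>w. poly p w = 0 \<Longrightarrow> norm w < 1"
    and "apply_shift_poly p y \<longlonglongrightarrow> 0"
  shows "y \<longlonglongrightarrow> 0"
  using assms
proof (induction "degree p" arbitrary: p)
  case 0
  then obtain a where a: "p = [:a:]" by (metis degree_eq_zeroE)
  then have "a \<noteq> 0" using 0 by auto
  have "(\<lambda>n. apply_shift_poly p y n / a) \<longlonglongrightarrow> 0 / a"
    using 0 \<open>a \<noteq> 0\<close> by (intro tendsto_intros) auto
  then show ?case using a \<open>a \<noteq> 0\<close> by (simp add: apply_shift_poly_def)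
next
  case (Suc k)
  then have "\<not> constant (poly p)" by (simp add: constant_degree)
  then obtain r where r: "poly p r = 0" using fundamental_theorem_of_algebra by blast
  then obtain q where q: "p = [:- r, 1:] * q" by (auto simp: poly_eq_0_iff_dvd elim: dvdE)
  have q0: "q \<noteq> 0" using q Suc.prems by auto
  have "degree p = Suc (degree q)" unfolding q using q0 by (subst degree_mult_eq) auto
  then have dq: "k = degree q" using Suc by simp
  have "apply_shift_poly p y = (\<lambda>n. apply_shift_poly q y (Suc n) - r * apply_shift_poly q y n)"
    unfolding q by (rule ext) (rule apply_shift_poly_linear_factor)
  then have "(\<lambda>n. apply_shift_poly q y (Suc n) - r * apply_shift_poly q y n) \<longlonglongrightarrow> 0"
    using Suc.prems(3) by simp
  then have "apply_shift_poly q y \<longlonglongrightarrow> 0"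
    using perturbed_contraction_tendsto_zero Suc.prems(2)[OF r] by blast
  moreover have "norm w < 1" if "poly q w = 0" for w using that Suc.prems(2)[of w] q by simp
  ultimately show ?case using Suc.hyps(1)[OF dq q0] by blast
qed

section \<open>Growth of a Pisot numeration\<close>

text \<open>In characteristic 0 the derivative of a minimal polynomial is a nonzero polynomial of smaller
  degree, so minimality forbids it to vanish at the same point.\<close>

lemma minimal_polynomial_simple_root:
  assumes "minimal_polynomial p z"
  shows "poly (pderiv (map_poly of_rat p)) z \<noteq> 0"
proof
  assume "poly (pderiv (map_poly of_rat p)) z = 0"
  moreover have "pderiv (map_poly of_rat p) = (map_poly of_rat (pderiv p) :: complex poly)"
    by (intro poly_eqI) (simp add: coeff_pderiv coeff_map_poly of_rat_mult of_rat_add)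
  ultimately have root: "poly (map_poly of_rat (pderiv p)) z = 0" by simp
  have "degree p \<noteq> 0"
  proof
    assume "degree p = 0"
    then obtain a where "p = [:a:]" by (metis degree_eq_zeroE)
    then show False using assms by (auto simp: minimal_polynomial_def map_poly_pCons)
  qed
  then have "pderiv p \<noteq> 0" by (simp add: pderiv_eq_0_iff)
  then have "degree p \<le> degree (pderiv p)"
    using assms root by (auto simp: minimal_polynomial_def)
  then show False using \<open>degree p \<noteq> 0\<close> by (simp add: degree_pderiv)
qed

text \<open>With the minimal polynomial written as \<open>p = (X - \<beta>) q\<close>, the recurrence \<open>p(S) u = 0\<close> says that
  \<open>q(S)\<close> annihilates \<open>(S - \<beta>) u\<close>. The roots of \<open>q\<close> are conjugates of \<open>\<beta>\<close>, and different from \<open>\<beta>\<close>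
  because \<open>\<beta>\<close> is a simple root of \<open>p\<close>; so they lie in the open unit disc.\<close>

lemma pisot_numeration_error_tendsto_zero:
  assumes "pisot_numeration d \<beta> u"
  shows "(\<lambda>n. real_of_int (u (Suc n)) - \<beta> * real_of_int (u n)) \<longlonglongrightarrow> 0"
proof -
  obtain P v where pisot: "pisot_number \<beta>"
    and min: "minimal_polynomial (map_poly of_int P) (complex_of_real \<beta>)"
    and deg: "degree P = d" and vu: "\<And>n. v (int n) = u n"
    and rec: "\<And>n. n \<ge> 1 \<Longrightarrow> v n = (\<Sum>i<d. - coeff P i * v (n - int d + int i))"
    using assms unfolding pisot_numeration_def by blast
  define p :: "complex poly" where "p = map_poly of_rat (map_poly of_int P)"
  have coeff_p: "coeff p i = of_int (coeff P i)" for i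
    by (simp add: p_def coeff_map_poly)
  have deg_p: "degree p = d"
    unfolding p_def using deg by (simp add: degree_map_poly)
  have lead: "coeff P d = 1"
  proof -
    have "coeff (map_poly of_int P :: rat poly) (degree (map_poly of_int P :: rat poly)) = 1"
      using min by (simp add: minimal_polynomial_def)
    then show ?thesis by (simp add: coeff_map_poly degree_map_poly deg)
  qed
  have root: "poly p \<beta> = 0" using min by (simp add: minimal_polynomial_def p_def)
  have p0: "p \<noteq> 0" using coeff_p[of d] lead by auto
  have d1: "d \<ge> 1"
  proof (rule ccontr)
    assume "\<not> d \<ge> 1"
    then have "degree p = 0" using deg_p by simp
    then obtain a where "p = [:a:]" by (metis degree_eq_zeroE)
    then show False using root p0 by auto
  qed
  have rec_u: "apply_shift_poly p (\<lambda>n. of_int (u n)) m = 0" for m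
  proof -
    have "int m + int d \<ge> 1" using d1 by simp
    from rec[OF this] have "v (int (m + d)) = (\<Sum>i<d. - coeff P i * v (int (m + i)))"
      by simp
    then have *: "u (m + d) = (\<Sum>i<d. - coeff P i * u (m + i))" by (simp only: vu)
    have "(\<Sum>i\<le>d. coeff P i * u (m + i)) = 0"
      unfolding lessThan_Suc_atMost[symmetric]
      by (simp add: lead * sum_negf)
    then have "(of_int (\<Sum>i\<le>d. coeff P i * u (m + i)) :: complex) = 0" by simp
    then show ?thesis by (simp add: apply_shift_poly_def deg_p coeff_p)
  qed
  obtain q where q: "p = [:- complex_of_real \<beta>, 1:] * q"
    using root by (auto simp: poly_eq_0_iff_dvd elim: dvdE)
  have small: "norm w < 1" if w: "poly q w = 0" for w
  proof -
    have "poly p w = 0" using w q by simp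
    then have "galois_conjugate \<beta> w" using min by (auto simp: galois_conjugate_def p_def)
    moreover have "w \<noteq> \<beta>"
    proof
      assume "w = \<beta>"
      have "pderiv p = [:- complex_of_real \<beta>, 1:] * pderiv q + q * pderiv [:- complex_of_real \<beta>, 1:]"
        unfolding q by (rule pderiv_mult)
      then have "poly (pderiv p) \<beta> = 0" using w \<open>w = \<beta>\<close> by simp
      then show False using minimal_polynomial_simple_root[OF min] by (simp add: p_def)
    qed
    ultimately show ?thesis using pisot by (auto simp: pisot_number_def)
  qed
  have "apply_shift_poly q (\<lambda>n. of_int (u (Suc n)) - complex_of_real \<beta> * of_int (u n)) = (\<lambda>_. 0)"
    using rec_u apply_shift_poly_linear_factor[of "complex_of_real \<beta>" q "\<lambda>n. of_int (u n)"]
    by (intro ext)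
      (simp only: apply_shift_poly_difference[of q "\<lambda>n. of_int (u n)"] q[symmetric])
  then have "apply_shift_poly q (\<lambda>n. of_int (u (Suc n)) - complex_of_real \<beta> * of_int (u n)) \<longlonglongrightarrow> 0"
    by (simp only: tendsto_const)
  moreover have "q \<noteq> 0" using p0 unfolding q by auto
  ultimately have "(\<lambda>n. of_int (u (Suc n)) - complex_of_real \<beta> * of_int (u n)) \<longlonglongrightarrow> 0"
    using small shift_poly_inverse_tendsto_zero[of q] by blast
  then have "(\<lambda>n. complex_of_real (of_int (u (Suc n)) - \<beta> * of_int (u n))) \<longlonglongrightarrow> complex_of_real 0"
    by simp
  then show ?thesis by (simp only: tendsto_of_real_iff)
qed

text \<open>If \<open>Y\<close> bounds the error, then \<open>u (n + 1) \<le> \<beta> * u n + Y \<le> (\<beta> + Y) * u n\<close>, where the last step uses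
  \<open>u n \<ge> 1\<close>.\<close>

lemma pisot_numeration_ratio_bounded:
  assumes "pisot_numeration d \<beta> u"
  obtains D :: int where "D \<ge> 0" and "\<And>n. u (Suc n) \<le> D * u n"
proof -
  have pos: "u n > 0" for n using assms by (auto simp: pisot_numeration_def)
  have beta: "\<beta> > 1" using assms by (auto simp: pisot_numeration_def pisot_number_def)
  have "Bseq (\<lambda>n. real_of_int (u (Suc n)) - \<beta> * real_of_int (u n))"
    using pisot_numeration_error_tendsto_zero[OF assms] by (intro convergent_imp_Bseq convergentI)
  then obtain Y where Y: "Y > 0" "\<And>n. \<bar>real_of_int (u (Suc n)) - \<beta> * real_of_int (u n)\<bar> \<le> Y"
    by (auto simp: Bseq_def)
  define D where "D = \<lceil>\<beta> + Y\<rceil>"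
  have D: "\<beta> + Y \<le> real_of_int D" by (simp add: D_def)
  have "u (Suc n) \<le> D * u n" for n
  proof -
    have un: "1 \<le> real_of_int (u n)" using pos[of n] by simp
    have "real_of_int (u (Suc n)) \<le> \<beta> * u n + Y" using Y(2)[of n] by linarith
    also have "\<dots> \<le> \<beta> * u n + Y * u n" using un Y(1) by simp
    also have "\<dots> = (\<beta> + Y) * u n" by (simp add: algebra_simps)
    also have "\<dots> \<le> real_of_int D * u n" using D un by (intro mult_right_mono) auto
    finally show ?thesis by (metis of_int_le_iff of_int_mult)
  qed
  moreover have "D \<ge> 0" using D beta Y(1) by linarith
  ultimately show thesis using that by blast
qed

text \<open>As soon as the error is below \<open>(\<beta> - 1) / 2\<close>, the inequality \<open>u n \<ge> 1\<close> forces
  \<open>u (n + 1) > u n\<close>. So \<open>u\<close> is eventually strictly increasing, although it need not be increasing from the start.\<close>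

lemma pisot_numeration_unbounded:
  assumes "pisot_numeration d \<beta> u"
  shows "finite {i. u i \<le> m}"
proof -
  have pos: "u n > 0" for n using assms by (auto simp: pisot_numeration_def)
  have beta: "(\<beta> - 1) / 2 > 0" using assms by (auto simp: pisot_numeration_def pisot_number_def)
  from LIMSEQ_D[OF pisot_numeration_error_tendsto_zero[OF assms] beta] obtain N
    where N: "\<And>n. n \<ge> N \<Longrightarrow> \<bar>real_of_int (u (Suc n)) - \<beta> * real_of_int (u n)\<bar> < (\<beta> - 1) / 2"
    by auto
  have step: "u n < u (Suc n)" if "n \<ge> N" for n
  proof -
    have "(\<beta> - 1) * 1 \<le> (\<beta> - 1) * real_of_int (u n)"
      using pos[of n] beta by (intro mult_left_mono) auto
    then have "(\<beta> - 1) \<le> \<beta> * real_of_int (u n) - u n" by (simp add: algebra_simps)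
    then have "real_of_int (u n) < real_of_int (u (Suc n))"
      using N[OF that] beta unfolding abs_less_iff by argo
    then show ?thesis by simp
  qed
  have grow: "u (N + k) > int k" for k
  proof (induction k)
    case 0
    then show ?case using pos by simp
  next
    case (Suc k)
    then show ?case using step[of "N + k"] by simp
  qed
  have "i \<le> N + nat m" if "u i \<le> m" for i
    using that grow[of "i - N"] by (cases "i \<ge> N") auto
  then have "{i. u i \<le> m} \<subseteq> {..N + nat m}" by auto
  then show ?thesis by (rule finite_subset) simp
qed

section \<open>Values of finite sequences\<close>

lemma seq_value_eq_sum:
  assumes "\<And>i. i \<ge> M \<Longrightarrow> a i = 0"
  shows "seq_value u a = (\<Sum>i<M. a i * u i)"
  unfolding seq_value_def
  using assms by (intro sum.mono_neutral_left) (auto simp: not_less[symmetric])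

lemma finite_seqs_common_bound:
  assumes "a \<in> finite_seqs" "b \<in> finite_seqs"
  shows "\<exists>M. \<forall>i\<ge>M. a i = 0 \<and> b i = 0"
proof -
  have "finite ({n. a n \<noteq> 0} \<union> {n. b n \<noteq> 0})" using assms by (simp add: finite_seqs_def)
  then obtain M where M: "{n. a n \<noteq> 0} \<union> {n. b n \<noteq> 0} \<subseteq> {..<M}"
    using finite_nat_bounded by blast
  have "a i = 0 \<and> b i = 0" if "i \<ge> M" for i using M that by fastforce
  then show ?thesis by blast
qed

lemma finite_seqs_add_diff:
  assumes "a \<in> finite_seqs" "b \<in> finite_seqs"
  shows "(\<lambda>i. a i + b i) \<in> finite_seqs" "(\<lambda>i. a i - b i) \<in> finite_seqs"
proof -
  have "finite ({n. a n \<noteq> 0} \<union> {n. b n \<noteq> 0})" using assms by (simp add: finite_seqs_def)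
  then show "(\<lambda>i. a i + b i) \<in> finite_seqs" "(\<lambda>i. a i - b i) \<in> finite_seqs"
    unfolding finite_seqs_def mem_Collect_eq by (rule finite_subset[rotated], force)+
qed

lemma seq_value_add_diff:
  assumes "a \<in> finite_seqs" "b \<in> finite_seqs"
  shows "seq_value u (\<lambda>i. a i + b i) = seq_value u a + seq_value u b"
    and "seq_value u (\<lambda>i. a i - b i) = seq_value u a - seq_value u b"
proof -
  obtain M where "\<forall>i\<ge>M. a i = 0 \<and> b i = 0"
    using finite_seqs_common_bound[OF assms] by blast
  then show "seq_value u (\<lambda>i. a i + b i) = seq_value u a + seq_value u b"
    and "seq_value u (\<lambda>i. a i - b i) = seq_value u a - seq_value u b"
    by (simp_all add: seq_value_eq_sum[of M] sum.distrib sum_subtractf algebra_simps)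
qed

lemma truncate_seq_finite: "truncate_seq a n \<in> finite_seqs"
proof -
  have "finite {i. truncate_seq a n i \<noteq> 0}"
    by (rule finite_subset[of _ "{..<n}"]) (auto simp: truncate_seq_def)
  then show ?thesis by (simp add: finite_seqs_def)
qed

definition unit_seq :: "nat \<Rightarrow> nat \<Rightarrow> int" where
  "unit_seq k = (\<lambda>i. if i = k then 1 else 0)"

lemma unit_seq_finite: "unit_seq k \<in> finite_seqs"
  by (simp add: finite_seqs_def unit_seq_def)

lemma seq_value_unit_seq: "seq_value u (unit_seq k) = u k"
  by (simp add: seq_value_def unit_seq_def)

section \<open>The greedy condition\<close>

text \<open>The local description of normalised expansions. The bound is stated for the sum over
  positions strictly below \<open>l\<close>, so that the case \<open>l = 0\<close> is just \<open>u 0 > 0\<close>.\<close>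

definition greedy_seq :: "(nat \<Rightarrow> int) \<Rightarrow> (nat \<Rightarrow> int) \<Rightarrow> bool" where
  "greedy_seq u a \<longleftrightarrow> (\<forall>i. a i \<ge> 0) \<and> (\<forall>l. (\<Sum>i<l. a i * u i) < u l)"

text \<open>At the highest position \<open>k\<close> where the two sequences differ, a larger digit of \<open>e\<close> would have to be
  compensated below \<open>k\<close>: the digits of \<open>a\<close> there would be worth at least \<open>u k\<close>, against the greedy
  condition.\<close>

lemma greedy_seq_lex_greatest:
  assumes pos: "\<And>i. u i > 0"
    and a: "a \<in> finite_seqs" "greedy_seq u a"
    and e: "e \<in> finite_seqs" "\<And>i. e i \<ge> 0"
    and eq: "seq_value u e = seq_value u a" and ne: "e \<noteq> a"
  shows "lex_less e a"
proof -
  obtain M where M: "\<forall>i\<ge>M. a i = 0 \<and> e i = 0"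
    using finite_seqs_common_bound[OF a(1) e(1)] by blast
  define K where "K = {i. e i \<noteq> a i}"
  have K_less: "i < M" if "i \<in> K" for i
    using that M by (cases "i < M") (auto simp: K_def)
  then have "K \<subseteq> {..<M}" by auto
  then have fin: "finite K" by (rule finite_subset) simp
  have "K \<noteq> {}" using ne by (auto simp: K_def)
  define k where "k = Max K"
  have kK: "k \<in> K" using fin \<open>K \<noteq> {}\<close> by (simp add: k_def)
  have above: "e j = a j" if "j > k" for j
    using Max_ge[OF fin, of j] that by (auto simp: K_def k_def)
  have kM: "k < M" using kK by (rule K_less)
  have "\<not> a k < e k"
  proof
    assume less: "a k < e k"
    have "0 = (\<Sum>i<M. (e i - a i) * u i)"
      using eq M by (simp add: seq_value_eq_sum[of M] sum_subtractf algebra_simps)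
    also have "\<dots> = (\<Sum>i<Suc k. (e i - a i) * u i)"
      using kM above by (intro sum.mono_neutral_right) (auto simp: not_less[symmetric])
    finally have "(\<Sum>i<k. a i * u i) = (\<Sum>i<k. e i * u i) + (e k - a k) * u k"
      by (simp add: sum_subtractf algebra_simps)
    moreover have "(\<Sum>i<k. e i * u i) \<ge> 0"
      using e(2) pos by (intro sum_nonneg mult_nonneg_nonneg) (auto simp: less_imp_le)
    moreover have "(e k - a k) * u k \<ge> 1 * u k"
      using less pos[of k] by (intro mult_right_mono) auto
    moreover have "(\<Sum>i<k. a i * u i) < u k" using a(2) by (simp add: greedy_seq_def)
    ultimately show False by linarith
  qed
  then have "e k < a k" using kK by (auto simp: K_def)
  then show ?thesis using above by (auto simp: lex_less_def)
qed

lemma lex_less_asym: "lex_less a b \<Longrightarrow> \<not> lex_less b a"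
  unfolding lex_less_def by (metis linorder_neqE_nat order_less_asym)

lemma greedy_expansion_eqI:
  assumes pos: "\<And>i. u i > 0"
    and a: "a \<in> finite_seqs" "greedy_seq u a" "seq_value u a = int n"
  shows "greedy_expansion u n = a"
  unfolding greedy_expansion_def
proof (rule the_equality)
  have rep: "a \<in> representations u n" using a by (auto simp: representations_def greedy_seq_def)
  have max: "\<forall>e\<in>representations u n. e \<noteq> a \<longrightarrow> lex_less e a"
    using a by (auto intro!: greedy_seq_lex_greatest[OF pos] simp: representations_def)
  show "a \<in> representations u n \<and> (\<forall>e\<in>representations u n. e \<noteq> a \<longrightarrow> lex_less e a)"
    using rep max by blast
  fix b assume b: "b \<in> representations u n \<and> (\<forall>e\<in>representations u n. e \<noteq> b \<longrightarrow> lex_less e b)"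
  show "b = a"
  proof (rule ccontr)
    assume "b \<noteq> a"
    then have "lex_less b a" "lex_less a b" using b rep max by auto
    then show False using lex_less_asym by blast
  qed
qed

lemma greedy_seq_in_normalised_finite:
  assumes pos: "\<And>i. u i > 0" and a: "a \<in> finite_seqs" "greedy_seq u a"
  shows "a \<in> normalised_finite u"
proof -
  have "seq_value u a \<ge> 0"
    unfolding seq_value_def using a(2) pos
    by (intro sum_nonneg mult_nonneg_nonneg) (auto simp: greedy_seq_def less_imp_le)
  then have "greedy_expansion u (nat (seq_value u a)) = a"
    using a by (intro greedy_expansion_eqI[OF pos]) auto
  then show ?thesis unfolding normalised_finite_def by (metis rangeI)
qed

text \<open>The greedy algorithm: with \<open>k\<close> the largest index such that \<open>u k \<le> n\<close>, expand \<open>n - u k\<close> and add 1 to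
  the digit at \<open>k\<close>. Below \<open>k\<close> nothing changes, and for \<open>l > k\<close> the whole value \<open>n\<close> is less than \<open>u l\<close>
  by the choice of \<open>k\<close>, whether or not \<open>u\<close> is increasing.\<close>

lemma greedy_seq_exists:
  assumes pos: "\<And>i. u i > 0" and u0: "u 0 = 1" and unb: "\<And>m. finite {i. u i \<le> m}"
    and "n \<ge> 0"
  shows "\<exists>a\<in>finite_seqs. greedy_seq u a \<and> seq_value u a = n"
  using \<open>n \<ge> 0\<close>
proof (induction "nat n" arbitrary: n rule: less_induct)
  case less
  show ?case
  proof (cases "n = 0")
    case True
    have "(\<lambda>_. 0) \<in> finite_seqs" "greedy_seq u (\<lambda>_. 0)" "seq_value u (\<lambda>_. 0) = n"
      using True pos by (auto simp: finite_seqs_def greedy_seq_def seq_value_def)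
    then show ?thesis by blast
  next
    case False
    define k where "k = Max {i. u i \<le> n}"
    have "0 \<in> {i. u i \<le> n}" using u0 False less.prems by simp
    then have "k \<in> {i. u i \<le> n}" unfolding k_def using unb by (intro Max_in) auto
    then have k: "u k \<le> n" by simp
    have above: "n < u j" if "j > k" for j
      using Max_ge[OF unb, of j n] that by (fastforce simp: k_def)
    have "nat (n - u k) < nat n" "n - u k \<ge> 0" using k pos[of k] by auto
    from less.hyps[OF this] obtain a
      where a: "a \<in> finite_seqs" "greedy_seq u a" "seq_value u a = n - u k" by blast
    define b where "b = (\<lambda>i. a i + unit_seq k i)"
    have bfin: "b \<in> finite_seqs" unfolding b_def
      using a(1) unit_seq_finite by (rule finite_seqs_add_diff)
    have bval: "seq_value u b = n"
      unfolding b_def using a(3) seq_value_add_diff(1)[OF a(1) unit_seq_finite]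
      by (simp add: seq_value_unit_seq)
    have bpos: "b i \<ge> 0" for i using a(2) by (auto simp: b_def greedy_seq_def unit_seq_def)
    have "(\<Sum>i<l. b i * u i) < u l" for l
    proof (cases "l \<le> k")
      case True
      then have "(\<Sum>i<l. b i * u i) = (\<Sum>i<l. a i * u i)"
        by (intro sum.cong) (auto simp: b_def unit_seq_def)
      then show ?thesis using a(2) by (simp add: greedy_seq_def)
    next
      case False
      obtain M where M: "\<forall>i\<ge>M. b i = 0"
        using finite_seqs_common_bound[OF bfin bfin] by auto
      have "(\<Sum>i<l. b i * u i) \<le> (\<Sum>i<max l M. b i * u i)"
        using bpos pos by (intro sum_mono2) (auto simp: less_imp_le)
      also have "\<dots> = seq_value u b" using M by (subst seq_value_eq_sum[of "max l M"]) auto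
      also have "\<dots> < u l" using bval above False by simp
      finally show ?thesis .
    qed
    then have "greedy_seq u b" using bpos by (simp add: greedy_seq_def)
    then show ?thesis using bfin bval by blast
  qed
qed

lemma greedy_seq_truncate:
  assumes pos: "\<And>i. u i > 0" and a: "greedy_seq u a"
  shows "greedy_seq u (truncate_seq a n)"
proof -
  have nn: "a i \<ge> 0" for i using a by (simp add: greedy_seq_def)
  have "(\<Sum>i<l. truncate_seq a n i * u i) < u l" for l
  proof -
    have "(\<Sum>i<l. truncate_seq a n i * u i) \<le> (\<Sum>i<l. a i * u i)"
      using nn pos by (intro sum_mono mult_right_mono) (auto simp: truncate_seq_def less_imp_le)
    also have "\<dots> < u l" using a by (simp add: greedy_seq_def)
    finally show ?thesis .
  qed
  then show ?thesis using nn by (auto simp: greedy_seq_def truncate_seq_def)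
qed

text \<open>The digit at \<open>i\<close> alone contributes \<open>a i * u i\<close> to a sum that stays below \<open>u (i + 1)\<close>.\<close>

lemma greedy_seq_digit_le:
  assumes pos: "\<And>i. u i > 0" and ratio: "\<And>n. u (Suc n) \<le> D * u n"
    and a: "greedy_seq u a"
  shows "a i \<le> D"
proof -
  have "(\<Sum>j<i. a j * u j) \<ge> 0"
    using a pos by (intro sum_nonneg mult_nonneg_nonneg) (auto simp: greedy_seq_def less_imp_le)
  then have "a i * u i \<le> (\<Sum>j<Suc i. a j * u j)" by simp
  also have "\<dots> < u (Suc i)" using a unfolding greedy_seq_def by blast
  also have "\<dots> \<le> D * u i" by (rule ratio)
  finally have "a i < D" using pos[of i] by simp
  then show ?thesis by simp
qed

section \<open>Limits of normalised expansions\<close>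

text \<open>Koenig's lemma, or sequential compactness of a product of finite sets: extend a prefix shared by
  infinitely many of the sequences by a letter that still leaves infinitely many of them.\<close>

lemma prefixwise_cluster_point:
  fixes w :: "nat \<Rightarrow> nat \<Rightarrow> 'a"
  assumes fin: "finite A" and w: "\<And>j i. w j i \<in> A"
  obtains f where "\<And>n. infinite {j. \<forall>i<n. w j i = f i}"
proof -
  have "\<exists>F. \<forall>n. infinite {j. \<forall>i<n. w j i = F n i} \<and> (\<forall>i<n. F (Suc n) i = F n i)"
  proof (rule dependent_nat_choice)
    show "\<exists>f. infinite {j. \<forall>i<0. w j i = f i}" by simp
  next
    fix f n assume inf: "infinite {j. \<forall>i<n. w j i = f i}"
    define S where "S = {j. \<forall>i<n. w j i = f i}"
    have "finite ((\<lambda>j. w j n) ` S)"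
      by (rule finite_subset[OF _ fin]) (use w in auto)
    with pigeonhole_infinite[of S "\<lambda>j. w j n"] inf obtain j0
      where "infinite {j \<in> S. w j n = w j0 n}" unfolding S_def by blast
    also have "{j \<in> S. w j n = w j0 n} = {j. \<forall>i<Suc n. w j i = (f(n := w j0 n)) i}"
      by (auto simp: S_def less_Suc_eq)
    finally show "\<exists>g. infinite {j. \<forall>i<Suc n. w j i = g i} \<and> (\<forall>i<n. g i = f i)"
      by (intro exI[of _ "f(n := w j0 n)"]) auto
  qed
  \<comment> \<open>\<open>F n\<close> is meaningful below \<open>n\<close> only; the limit takes the first meaningful value at each position.\<close>
  then obtain F where F: "\<And>n. infinite {j. \<forall>i<n. w j i = F n i}"
    and step: "\<And>n i. i < n \<Longrightarrow> F (Suc n) i = F n i" by blast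
  have stable: "F n i = F (Suc i) i" if "i < n" for n i
    using that by (induction n) (auto simp: less_Suc_eq step)
  have "infinite {j. \<forall>i<n. w j i = F (Suc i) i}" for n
  proof -
    have "(\<forall>i<n. w j i = F n i) \<longleftrightarrow> (\<forall>i<n. w j i = F (Suc i) i)" for j
      using stable[of _ n] by metis
    then show ?thesis using F[of n] by simp
  qed
  then show thesis by (rule that)
qed

text \<open>Preservation of zeros in a form free of the supremum norm and of extended arithmetic: the constant
  depends only on the bound \<open>C\<close> for the digits.\<close>

lemma preserves_zeros_bound:
  assumes "preserves_zeros u"
  obtains K where "\<And>h n. h \<in> finite_seqs \<Longrightarrow> (\<And>i. \<bar>h i\<bar> \<le> C) \<Longrightarrow> (\<And>i. i < n \<Longrightarrow> h i = 0)
    \<Longrightarrow> seq_val u h \<ge> enat (n - K)"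
proof -
  obtain K where K: "\<And>h. h \<in> finite_seqs \<Longrightarrow> sup_norm h \<le> int (nat C) \<Longrightarrow>
      seq_val u h \<ge> seq_ord h - enat K"
    using assms unfolding preserves_zeros_def by meson
  have "seq_val u h \<ge> enat (n - K)"
    if h: "h \<in> finite_seqs" "\<And>i. \<bar>h i\<bar> \<le> C" "\<And>i. i < n \<Longrightarrow> h i = 0" for h n
  proof -
    have "\<bar>h i\<bar> \<le> int (nat C)" for i using h(2)[of i] by linarith
    then have "sup_norm h \<le> int (nat C)" unfolding sup_norm_def by (intro cSUP_least) auto
    then have val: "seq_val u h \<ge> seq_ord h - enat K" using K h(1) by blast
    have "seq_ord h \<ge> enat n" unfolding seq_ord_def
      using h(3) by (intro INF_greatest) (auto simp: not_less[symmetric])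
    then have "enat n - enat K \<le> seq_ord h - enat K" by (cases "seq_ord h") auto
    then show ?thesis using val by (metis idiff_enat_enat order_trans)
  qed
  then show thesis using that by blast
qed

lemma tendsto_infinity_enat_shift:
  assumes "\<And>n. f n \<ge> enat (n - K)"
  shows "f \<longlonglongrightarrow> \<infinity>"
proof (rule order_tendstoI)
  fix a :: enat assume "a < \<infinity>"
  then obtain m where m: "a = enat m" by (cases a) auto
  have "a < f n" if "n \<ge> Suc (m + K)" for n
  proof -
    have "enat m < enat (n - K)" using that by simp
    then show ?thesis using m assms[of n] by (metis order_less_le_trans)
  qed
  then show "\<forall>\<^sub>F n in sequentially. a < f n" by (auto simp: eventually_sequentially)
next
  fix a :: enat assume "\<infinity> < a"
  then show "\<forall>\<^sub>F n in sequentially. f n < a" by simp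
qed

theorem proposition18:
  fixes d :: nat and \<beta> :: real and u g :: "nat \<Rightarrow> int"
  assumes "pisot_numeration d \<beta> u"
    and "preserves_zeros u"
    and "g \<in> bounded_seqs"
  shows "\<exists>g'\<in>normalised_seqs u. (\<lambda>n. g n - g' n) \<in> null_seqs u"
proof -
  have pos: "\<And>i. u i > 0" and u0: "u 0 = 1"
    using assms(1) by (auto simp: pisot_numeration_def)
  note unb = pisot_numeration_unbounded[OF assms(1)]
  obtain D where D: "D \<ge> 0" "\<And>n. u (Suc n) \<le> D * u n"
    using pisot_numeration_ratio_bounded[OF assms(1)] by blast
  obtain B where B: "\<And>n. \<bar>g n\<bar> \<le> B" using assms(3) by (auto simp: bounded_seqs_def)
  define x where "x N = seq_value u (truncate_seq g N)" for N
  \<comment> \<open>Adding \<open>u m\<close> makes the value nonnegative; \<open>m \<ge> N\<close> keeps the correction away from low positions.\<close>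
  have "\<exists>a m. N \<le> m \<and> a \<in> finite_seqs \<and> greedy_seq u a \<and> seq_value u a = x N + u m" for N
  proof -
    have "finite ({i. u i \<le> - x N} \<union> {..<N})" using unb by simp
    then obtain m where "m \<notin> {i. u i \<le> - x N} \<union> {..<N}"
      using ex_new_if_finite infinite_UNIV_nat by blast
    then have m: "N \<le> m" "x N + u m \<ge> 0" by auto
    then show ?thesis using greedy_seq_exists[OF pos u0 unb m(2)] by blast
  qed
  then obtain w m where m: "\<And>N. N \<le> m N" and wfin: "\<And>N. w N \<in> finite_seqs"
    and wg: "\<And>N. greedy_seq u (w N)" and wval: "\<And>N. seq_value u (w N) = x N + u (m N)"
    by metis
  have w_nonneg: "w N i \<ge> 0" for N i using wg by (simp add: greedy_seq_def)
  have w_le: "w N i \<le> D" for N i by (rule greedy_seq_digit_le[OF pos D(2) wg])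
  have "w N i \<in> {0..D}" for N i using w_nonneg w_le by simp
  then obtain g' where g': "\<And>n. infinite {N. \<forall>i<n. w N i = g' i}"
    using prefixwise_cluster_point[of "{0..D}" w] by blast
  have late: "\<exists>N\<ge>n. \<forall>i<n. w N i = g' i" for n
    using g'[of n] by (auto simp: infinite_nat_iff_unbounded_le)
  have g'_range: "0 \<le> g' i" "g' i \<le> D" for i
    using late[of "Suc i"] w_nonneg w_le by (metis lessI)+
  have g'_bdd: "\<bar>g' i\<bar> \<le> D" for i using g'_range[of i] by simp
  have "truncate_seq g' n \<in> normalised_finite u" for n
  proof -
    obtain N where "\<forall>i<n. w N i = g' i" using late by blast
    then have "truncate_seq g' n = truncate_seq (w N) n" by (auto simp: truncate_seq_def)
    then show ?thesis
      using greedy_seq_in_normalised_finite[OF pos truncate_seq_finite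
          greedy_seq_truncate[OF pos wg]] by simp
  qed
  then have normalised: "g' \<in> normalised_seqs u"
    using g'_bdd by (auto simp: normalised_seqs_def bounded_seqs_def)
  \<comment> \<open>\<open>D\<close> bounds the digits of the \<open>w N\<close>, \<open>B\<close> those of \<open>g\<close>, and 1 is the digit of the correction.\<close>
  obtain K where K: "\<And>h n. h \<in> finite_seqs \<Longrightarrow> (\<And>i. \<bar>h i\<bar> \<le> D + B + 1)
      \<Longrightarrow> (\<And>i. i < n \<Longrightarrow> h i = 0) \<Longrightarrow> seq_val u h \<ge> enat (n - K)"
    using preserves_zeros_bound[OF assms(2)] by blast
  have "seq_val u (truncate_seq (\<lambda>i. g i - g' i) n) \<ge> enat (n - K)" for n
  proof -
    obtain N where N: "N \<ge> n" "\<And>i. i < n \<Longrightarrow> w N i = g' i" using late by blast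
    \<comment> \<open>\<open>h\<close> has the same value as the truncation of \<open>g - g'\<close>, but all its digits lie at positions \<open>\<ge> n\<close>.\<close>
    define tail where "tail a = (\<lambda>i. a i - truncate_seq a n i)" for a
    define h where "h = (\<lambda>i. tail (w N) i - (tail (truncate_seq g N) i + unit_seq (m N) i))"
    have trunc2: "truncate_seq (truncate_seq g N) n = truncate_seq g n"
      using N(1) by (auto simp: truncate_seq_def)
    have tail_fin: "tail a \<in> finite_seqs" if "a \<in> finite_seqs" for a
      unfolding tail_def by (rule finite_seqs_add_diff(2)[OF that truncate_seq_finite])
    have tail_val: "seq_value u (tail a) = seq_value u a - seq_value u (truncate_seq a n)"
      if "a \<in> finite_seqs" for a
      unfolding tail_def by (rule seq_value_add_diff(2)[OF that truncate_seq_finite])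
    have rest_fin: "(\<lambda>i. tail (truncate_seq g N) i + unit_seq (m N) i) \<in> finite_seqs"
      by (intro finite_seqs_add_diff(1) tail_fin truncate_seq_finite unit_seq_finite)
    have hfin: "h \<in> finite_seqs" unfolding h_def
      by (intro finite_seqs_add_diff(2) tail_fin wfin rest_fin)
    have "seq_value u h = (seq_value u (w N) - seq_value u (truncate_seq (w N) n))
        - ((x N - x n) + u (m N))"
      unfolding h_def
      by (simp add: seq_value_add_diff tail_val tail_fin wfin rest_fin truncate_seq_finite
          unit_seq_finite seq_value_unit_seq trunc2 x_def)
    also have "\<dots> = x n - seq_value u (truncate_seq (w N) n)" by (simp add: wval)
    also have "truncate_seq (w N) n = truncate_seq g' n"
      using N(2) by (auto simp: truncate_seq_def)
    also have "x n - seq_value u (truncate_seq g' n)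
        = seq_value u (\<lambda>i. truncate_seq g n i - truncate_seq g' n i)"
      by (simp add: x_def seq_value_add_diff truncate_seq_finite)
    also have "(\<lambda>i. truncate_seq g n i - truncate_seq g' n i) = truncate_seq (\<lambda>i. g i - g' i) n"
      by (auto simp: truncate_seq_def)
    finally have val: "seq_val u h = seq_val u (truncate_seq (\<lambda>i. g i - g' i) n)"
      by (simp add: seq_val_def)
    have "\<bar>h i\<bar> \<le> D + B + 1" for i
      using w_nonneg[of N i] w_le[of N i] B[of i]
      by (auto simp: h_def tail_def truncate_seq_def unit_seq_def)
    moreover have "h i = 0" if "i < n" for i
      using that N(1) m[of N] by (auto simp: h_def tail_def truncate_seq_def unit_seq_def)
    ultimately show ?thesis using K[OF hfin] val by simp
  qed
  then have "(\<lambda>n. seq_val u (truncate_seq (\<lambda>i. g i - g' i) n)) \<longlonglongrightarrow> \<infinity>"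
    by (rule tendsto_infinity_enat_shift)
  moreover have "\<bar>g i - g' i\<bar> \<le> B + D" for i using B[of i] g'_bdd[of i] by linarith
  ultimately have "(\<lambda>i. g i - g' i) \<in> null_seqs u"
    by (auto simp: null_seqs_def bounded_seqs_def)
  then show ?thesis using normalised by blast
qed

end
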